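(* Let $k\ge 2$ and let $n_0,n_1,\dots,n_{k-1}\ge 1$ be positive integers. Then \[ N_k(n_0,\dots,n_{k-1})\le \sum_{i=0}^{k-1} L_k(n_0,\ldots,n_{i-1},\,n_i-1,\,n_{i+1},\ldots,n_{k-1}). \] Moreover, the inequality is strict if $k>2$.
   Context: Words are over the alphabet $\Sigma=\{0,1,\dots,k-1\}$ and are compared lexicographically with $0<1<\cdots<k-1$. A necklace is the lexicographically smallest word in an equivalence class of words under rotation. A Lyndon word is a (non-empty) necklace that is strictly smaller than any of its non-trivial rotations (so every word of length 1 is a Lyndon word). For non-negative integers $m_0,\dots,m_{k-1}$ with positive sum, $N_k(m_0,\dots,m_{k-1})$ denotes the number of necklaces over $\Sigma$ in which each symbol $i$ appears precisely $m_i$ times, and $L_k(m_0,\dots,m_{k-1})$ denotes the number of Lyndon words over $\Sigma$ in which each symbol $i$ appears precisely $m_i$ times. *)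

theory Defs
  imports Main "HOL-Library.List_Lexorder"
begin

text \<open>
  Words over the alphabet $\{0,\dots,k-1\}$ are lists of natural numbers with all entries below
  \<open>k\<close>; \<open><\<close> and \<open>\<le>\<close> on lists are the lexicographic order of
  \<^theory>\<open>HOL-Library.List_Lexorder\<close>.
\<close>

definition words :: "nat \<Rightarrow> nat list set" where
  "words k = {w. set w \<subseteq> {..<k}}"

definition rotation_class :: "nat list \<Rightarrow> nat list set" where
  "rotation_class w = {rotate j w | j. True}"

definition necklace :: "nat list \<Rightarrow> bool" where
  "necklace w \<longleftrightarrow> (\<forall>v \<in> rotation_class w. w \<le> v)"

text \<open>
  A rotation is non-trivial if it moves a proper non-empty prefix, even when the resulting word
  is \<open>w\<close> again; thus periodic words such as \<open>[0, 0]\<close> are not Lyndon words.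
\<close>

definition lyndon :: "nat list \<Rightarrow> bool" where
  "lyndon w \<longleftrightarrow> w \<noteq> [] \<and> necklace w \<and> (\<forall>j. 0 < j \<and> j < length w \<longrightarrow> w < rotate j w)"

text \<open>
  A content vector $(m_0,\dots,m_{k-1})$ is a function \<open>m\<close> of which only the values at
  arguments below \<open>k\<close> matter.
\<close>

definition has_content :: "nat \<Rightarrow> (nat \<Rightarrow> nat) \<Rightarrow> nat list \<Rightarrow> bool" where
  "has_content k m w \<longleftrightarrow> (\<forall>i<k. count_list w i = m i)"

definition num_necklaces :: "nat \<Rightarrow> (nat \<Rightarrow> nat) \<Rightarrow> nat" where
  "num_necklaces k m = card {w \<in> words k. necklace w \<and> has_content k m w}"

definition num_lyndon :: "nat \<Rightarrow> (nat \<Rightarrow> nat) \<Rightarrow> nat" where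
  "num_lyndon k m = card {w \<in> words k. lyndon w \<and> has_content k m w}"

end

theory Submission
  imports Defs "HOL-Number_Theory.Totient"
begin

text \<open>
  Let $T$ be the sum of the $n_i$ and let $M$ be the number of words with content $n$. Counting
  pairs of a word and a rotation gives $T \cdot N = M + F$, where $F$ counts the words fixed by
  a rotation by $j$, summed over $0 < j < T$. Deleting the first letter gives
  $(T-1) \sum_i L_i = M - I$, where $I$ counts the words whose tail is not primitive. The claim
  becomes $(T-1) F + T \cdot I \le M$.

  Let $s$ be a rarest symbol, with multiplicity $a$. A word is determined by the positions of
  $s$ and by the word left after erasing $s$, and both inherit every periodicity of the word.
  This reduces the inequality to binary words of length $T \ge 2a$ with $a$ marked
  positions, where it says that certain sums of binomial coefficients $T/d \choose a/d$ over
  divisors are at most $T \choose a$. Equality occurs for many small values of $a$ and $T$, so the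
  cases $a \le 4$ are computed exactly and only $a \ge 5$ is estimated. For $k > 2$ the inequality is
  strict because the erased word has at least two different letters, and so it can be primitive.
\<close>

subsection \<open>Binomial coefficients at divisors\<close>

text \<open>A single summand of Vandermonde's convolution is at most the whole sum.\<close>

lemma binomial_mult_le: "(p choose i) * (q choose j) \<le> (p + q) choose (i + j)"
proof -
  have "(\<Sum>k\<in>{i}. (p choose k) * (q choose (i + j - k)))
      \<le> (\<Sum>k\<le>i + j. (p choose k) * (q choose (i + j - k)))"
    by (intro sum_mono2) auto
  then show ?thesis by (simp add: vandermonde)
qed

lemma le_binomial:
  assumes "0 < k" "k < n" shows "n \<le> n choose k"
  using assms
proof (induction n arbitrary: k)
  case (Suc n)
  show ?case
  proof (cases "k = n")
    case False
    with Suc.prems have "n \<le> n choose k" by (intro Suc.IH) auto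
    moreover obtain k' where k': "k = Suc k'" using Suc.prems by (cases k) auto
    moreover have "0 < n choose k'" using Suc.prems k' by simp
    moreover have "Suc n choose k = (n choose k') + (n choose k)" using k' by simp
    ultimately show ?thesis by linarith
  qed auto
qed auto

lemma totient_mult_binomial_le:
  assumes d: "3 \<le> d" and c: "1 \<le> c" and e: "2 * c \<le> e" and cd: "4 \<le> c * d"
    and m: "(e * d) div 2 \<le> m"
  shows "totient d * ((e - 1) choose (c - 1)) \<le> (m - 1) choose ((c * d) div 2 - 1)"
proof -
  have tot: "totient d \<le> d - 1" using totient_less[of d] d by linarith
  have ed: "e * d = 2 * e + e * (d - 2)" "c * d = 2 * c + c * (d - 2)"
    using d by (auto simp: algebra_simps dest!: le_Suc_ex)
  have div: "(e * d) div 2 = e + (e * (d - 2)) div 2" "(c * d) div 2 = c + (c * (d - 2)) div 2"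
    unfolding ed by simp_all
  have le: "c * (d - 2) \<le> (e * (d - 2)) div 2"
    using mult_le_mono1[OF e, of "d - 2"] unfolding mult.assoc by linarith
  show ?thesis
  proof (cases "c = 1")
    case True
    have "2 * d \<le> e * d" using e True by (intro mult_le_mono1) simp
    then have "d \<le> m" using m by linarith
    then have "m - 1 \<le> (m - 1) choose (d div 2 - 1)"
      using d cd True by (intro le_binomial) auto
    then show ?thesis using True tot \<open>d \<le> m\<close> by simp
  next
    case False
    then have c2: "2 \<le> c" using c by simp
    define u where "u = c * (d - 2)"
    have u: "2 \<le> u" using mult_mono[of 2 c 1 "d - 2"] c2 d by (simp add: u_def)
    have me: "u \<le> m - e" "e \<le> m" using m le unfolding div(1) u_def by auto
    have "d - 1 \<le> m - e"
    proof -
      have "2 * (d - 2) \<le> c * (d - 2)" using c2 by simp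
      then show ?thesis using me u_def d by linarith
    qed
    also have "\<dots> \<le> (m - e) choose (u div 2)"
      using u me by (intro le_binomial) auto
    finally have "totient d * ((e - 1) choose (c - 1)) \<le> ((m - e) choose (u div 2)) * ((e - 1) choose (c - 1))"
      using tot by (intro mult_right_mono) auto
    also have "\<dots> \<le> ((m - e) + (e - 1)) choose (u div 2 + (c - 1))"
      by (rule binomial_mult_le)
    also have "(m - e) + (e - 1) = m - 1" using me e c by linarith
    also have "u div 2 + (c - 1) = (c * d) div 2 - 1"
      using c unfolding div(2) u_def by linarith
    finally show ?thesis .
  qed
qed

text \<open>From $y$ to $y + 1$ the left side grows by $(y+1)/(y+1-s)$ and the right side by at
  least $(2y+2)/(2y+2-r)$, which is no smaller because \<open>2 * s \<le> r\<close>. Hence such a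
  bound has to be checked at one starting value only.\<close>

lemma binomial_ratio_step:
  assumes "2 * s \<le> r" "r \<le> 2 * y" "K * (y choose s) \<le> (2 * y) choose r"
  shows "K * (Suc y choose s) \<le> (2 * Suc y) choose r"
proof -
  define p where "p = 2 * y + 2 - r"
  have p: "2 \<le> p" "p \<le> 2 * (y + 1 - s)" using assms p_def by auto
  have b1: "(Suc y choose s) * (y + 1 - s) = (y choose s) * (y + 1)"
    using binomial_absorb_comp[of "Suc y" s] assms by (simp add: mult.commute)
  have b2: "((2 * y + 2) choose r) * p = (2 * y + 2) * ((2 * y + 1) choose r)"
    using binomial_absorb_comp[of "2 * y + 2" r] by (simp add: mult.commute p_def)
  have b3: "((2 * y + 1) choose r) \<ge> (2 * y) choose r" by (rule binomial_right_mono) simp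
  have "p * (K * (Suc y choose s)) \<le> 2 * (y + 1 - s) * (K * (Suc y choose s))"
    using p by (intro mult_right_mono) auto
  also have "\<dots> = 2 * K * ((Suc y choose s) * (y + 1 - s))" by (simp only: ac_simps)
  also have "\<dots> = 2 * (y + 1) * (K * (y choose s))" unfolding b1 by (simp only: ac_simps)
  also have "\<dots> \<le> 2 * (y + 1) * ((2 * y + 1) choose r)" using assms(3) b3 by (intro mult_left_mono) auto
  also have "\<dots> = ((2 * y + 2) choose r) * p" unfolding b2 by (simp add: algebra_simps)
  finally show ?thesis using p by (simp add: mult.commute)
qed

lemma binomial_ratio_ge:
  assumes "2 * s \<le> r" "r \<le> 2 * y0" "K * (y0 choose s) \<le> (2 * y0) choose r" "y0 \<le> y"
  shows "K * (y choose s) \<le> (2 * y) choose r"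
  using assms(4)
proof (induction y rule: dec_induct)
  case (step y)
  then show ?case using assms by (intro binomial_ratio_step) auto
qed (use assms in auto)

lemma binomial_ratio_large:
  assumes "10 \<le> a" "a - 1 \<le> y"
  shows "a * (a - 1) * (y choose (a div 2 - 1)) \<le> (2 * y) choose (a - 2)"
proof -
  \<comment> \<open>The factor $24 = 4!$ clears the denominator of \<open>(a - 1) choose 4\<close>.
    In terms of $b = a - 10$ the difference of the two sides has nonnegative coefficients.\<close>
  have "24 * (a * (a - 1)) \<le> (a - 1) * (a - 2) * (a - 3) * (a - 4)"
  proof -
    obtain b where b: "a = b + 10" using assms(1) le_Suc_ex[of 10 a] by auto
    show ?thesis unfolding b by (simp add: algebra_simps)
  qed
  also have "\<dots> = 24 * ((a - 1) choose 4)"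
  proof -
    have h: "4 * ((a - 1) choose 4) = (a - 1) * ((a - 2) choose 3)"
      "3 * ((a - 2) choose 3) = (a - 2) * ((a - 3) choose 2)"
      "2 * ((a - 3) choose 2) = (a - 3) * (a - 4)"
      using times_binomial_minus1_eq[of 4 "a - 1"] times_binomial_minus1_eq[of 3 "a - 2"]
        times_binomial_minus1_eq[of 2 "a - 3"]
      by (simp_all add: numeral_eq_Suc)
    have "24 * ((a - 1) choose 4) = 6 * (4 * ((a - 1) choose 4))" by simp
    also have "\<dots> = (a - 1) * (2 * (3 * ((a - 2) choose 3)))" unfolding h(1) by simp
    also have "\<dots> = (a - 1) * ((a - 2) * (2 * ((a - 3) choose 2)))" unfolding h(2) by simp
    finally show ?thesis unfolding h(3) by (simp only: ac_simps)
  qed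
  finally have "a * (a - 1) \<le> (a - 1) choose 4" by simp
  also have "\<dots> \<le> y choose 4" using assms by (intro binomial_right_mono)
  also have "\<dots> \<le> y choose (a - 2 - (a div 2 - 1))"
    using assms by (intro binomial_mono) auto
  finally have "a * (a - 1) * (y choose (a div 2 - 1))
      \<le> (y choose (a - 2 - (a div 2 - 1))) * (y choose (a div 2 - 1))"
    by (intro mult_right_mono) auto
  also have "\<dots> \<le> (y + y) choose (a - 2 - (a div 2 - 1) + (a div 2 - 1))"
    by (rule binomial_mult_le)
  also have "a - 2 - (a div 2 - 1) + (a div 2 - 1) = a - 2" using assms by linarith
  finally show ?thesis by (simp only: mult_2)
qed

text \<open>A divisor $d > 1$ is determined by its cofactor \<open>a div d\<close>, which lies
  between 1 and \<open>a div 2\<close>.\<close>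

lemma card_divisors_gt_one_le:
  assumes "0 < (a::nat)" shows "card {d. d dvd a \<and> 1 < d} \<le> a div 2"
proof -
  have "{d. d dvd a \<and> 1 < d} \<subseteq> (\<lambda>t. a div t) ` {1..a div 2}"
  proof
    fix d assume "d \<in> {d. d dvd a \<and> 1 < d}"
    then obtain t where t: "a = d * t" "1 < d" by (auto simp: dvd_def)
    have "2 * t \<le> d * t" using t by (intro mult_le_mono1) simp
    then have "t \<le> a div 2" using t by linarith
    then have "t \<in> {1..a div 2}" using t assms by (auto simp: Suc_le_eq intro: Nat.gr0I)
    moreover have "d = a div t" using t assms by simp
    ultimately show "d \<in> (\<lambda>t. a div t) ` {1..a div 2}" by blast
  qed
  then have "card {d. d dvd a \<and> 1 < d} \<le> card ((\<lambda>t. a div t) ` {1..a div 2})"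
    by (intro card_mono) auto
  also have "\<dots> \<le> a div 2" using card_image_le[of "{1..a div 2}"] by simp
  finally show ?thesis .
qed

text \<open>The form that the divisor sum takes once every summand is replaced by one common bound:
  the first factor is the weighted number of summands.\<close>

lemma binomial_ratio_main:
  assumes a: "5 \<le> a" and n: "2 * a \<le> n"
  shows "((a - 1) * card {d. d dvd a \<and> 1 < d} + a * card {q. prime q \<and> q dvd a - 1})
    * ((n div 2 - 1) choose (a div 2 - 1)) \<le> (n - 2) choose (a - 2)"
proof -
  define D where "D = card {d. d dvd a \<and> 1 < d}"
  define P where "P = card {q. prime q \<and> q dvd a - 1}"
  define y where "y = n div 2 - 1"
  have y: "a - 1 \<le> y" "2 * y \<le> n - 2" using n a y_def by auto
  have D: "D \<le> a div 2" unfolding D_def using a by (intro card_divisors_gt_one_le) auto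
  have "P \<le> card {d. d dvd a - 1 \<and> 1 < d}"
    unfolding P_def using a by (intro card_mono) (auto simp: prime_gt_1_nat prime_gt_Suc_0_nat intro: finite_subset[OF _ finite_divisors_nat[of "a - 1"]])
  also have "\<dots> \<le> (a - 1) div 2" using a by (intro card_divisors_gt_one_le) auto
  finally have P: "P \<le> (a - 1) div 2" .
  have gen: "(a - 1) * D + a * P \<le> a * (a - 1)"
  proof -
    have "(a - 1) * (2 * D) \<le> (a - 1) * a" "a * (2 * P) \<le> a * (a - 1)"
      using D P by (intro mult_le_mono2; linarith)+
    then show ?thesis by (simp only: mult.left_commute[of _ 2] mult.commute[of "a - 1" a])
  qed
  have small: ?thesis if "K * ((a - 1) choose (a div 2 - 1)) \<le> (2 * (a - 1)) choose (a - 2)"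
    "(a - 1) * D + a * P \<le> K" for K
  proof -
    have "((a - 1) * D + a * P) * (y choose (a div 2 - 1)) \<le> K * (y choose (a div 2 - 1))"
      by (rule mult_le_mono1[OF that(2)])
    also have "\<dots> \<le> (2 * y) choose (a - 2)"
      by (rule binomial_ratio_ge[OF _ _ that(1) y(1)]) (use a in auto)
    also have "\<dots> \<le> (n - 2) choose (a - 2)" using y by (intro binomial_right_mono)
    finally show ?thesis unfolding D_def P_def y_def .
  qed
  consider "a = 5" | "a = 6" | "a = 7" | "a = 8" | "a = 9" | "10 \<le> a" using a by linarith
  then show ?thesis
  proof cases
    case 1
    have "{d. d dvd (5::nat) \<and> 1 < d} = {5}"
    proof -
      have "prime (5::nat)" by simp
      then show ?thesis using prime_nat_iff by auto
    qed
    then have "D = 1" using 1 D_def by simp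
    moreover have "{q. prime q \<and> q dvd (4::nat)} = {2}"
      using prime_dvd_power[of _ "2::nat" 2] primes_dvd_imp_eq[of _ "2::nat"] by auto
    then have "P = 1" using 1 P_def by simp
    ultimately show ?thesis using 1 by (intro small[of 14]) (simp_all add: binomial_fact' fact_numeral)
  next
    case 2
    have "{q. prime q \<and> q dvd (5::nat)} = {5}"
      using primes_dvd_imp_eq[of _ "5::nat"] by auto
    then have "P = 1" using 2 P_def by simp
    then show ?thesis using 2 D by (intro small[of 21]) (simp_all add: binomial_fact' fact_numeral)
  next
    case 3
    then show ?thesis using gen by (intro small[of 42]) (simp_all add: binomial_fact' fact_numeral)
  next
    case 4
    then show ?thesis using gen by (intro small[of 56]) (simp_all add: binomial_fact' fact_numeral)
  next
    case 5
    then show ?thesis using gen by (intro small[of 72]) (simp_all add: binomial_fact' fact_numeral)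
  next
    case 6
    then show ?thesis using gen by (intro small[of "a * (a - 1)"] binomial_ratio_large) auto
  qed
qed

text \<open>The inequality on binary words of length \<open>n\<close> with \<open>a\<close> marked positions, with every binomial
  coefficient replaced by means of $a {n \choose a} = n {n-1 \choose a-1}$ and the common factor
  $n (n - 1)$ cancelled.\<close>

lemma binomial_divisor_sum_le:
  assumes a: "2 \<le> a" and n: "2 * a \<le> n"
  shows "(a - 1) * ((\<Sum>d | d dvd a \<and> d dvd n \<and> 1 < d. totient d * ((n div d - 1) choose (a div d - 1)))
      + (\<Sum>q | prime q \<and> q dvd a \<and> q dvd n - 1. ((n - 1) div q - 1) choose (a div q - 1)))
    + a * (\<Sum>q | prime q \<and> q dvd a - 1 \<and> q dvd n - 1. ((n - 1) div q - 1) choose ((a - 1) div q - 1))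
    \<le> (n - 2) choose (a - 2)"
proof (cases "5 \<le> a")
  case True
  define A where "A = {d. d dvd a \<and> d dvd n \<and> 1 < d}"
  define B where "B = {q. prime q \<and> q dvd a \<and> q dvd n - 1}"
  define C where "C = {q. prime q \<and> q dvd a - 1 \<and> q dvd n - 1}"
  define X where "X = (n div 2 - 1) choose (a div 2 - 1)"
  have fin: "finite {d. d dvd a \<and> 1 < d}" "finite {q. prime q \<and> q dvd a - 1}"
    using a by (auto intro: finite_subset[OF _ finite_divisors_nat[of a]] finite_subset[OF _ finite_divisors_nat[of "a - 1"]])
  have sub: "A \<union> B \<subseteq> {d. d dvd a \<and> 1 < d}" "C \<subseteq> {q. prime q \<and> q dvd a - 1}"
    by (auto simp: A_def B_def C_def prime_gt_Suc_0_nat)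
  have finAB: "finite A" "finite B" "finite C" using sub fin by (auto intro: finite_subset)
  \<comment> \<open>This makes \<open>A\<close> and \<open>B\<close> disjoint sets of divisors of
    \<open>a\<close>, so that together they have no more elements than there are divisors exceeding
    1. It also excludes $n = 2a$ in the bound for \<open>B\<close>.\<close>
  have disj: "False" if "d dvd n" "d dvd n - 1" "1 < d" for d
  proof -
    have "d dvd n - (n - 1)" using that(1,2) by (rule dvd_diff_nat)
    moreover have "n - (n - 1) = 1" using n a by simp
    ultimately show False using that(3) by simp
  qed
  \<comment> \<open>\<open>X\<close> is the term of the divisor 2, rounded down, and serves as the
    common bound. \<open>N\<close> will be \<open>n\<close> for the sum over \<open>A\<close> and
    \<open>n - 1\<close> for the sum over \<open>B\<close>.\<close>
  have key: "totient d * ((N div d - 1) choose (a div d - 1)) \<le> X"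
    if d: "d dvd a" "d dvd N" "1 < d" and N: "2 * a \<le> N" "N \<le> n" for d N
  proof (cases "d = 2")
    case True
    then show ?thesis unfolding X_def using N by (auto intro!: binomial_right_mono diff_le_mono div_le_mono)
  next
    case False
    then have "3 \<le> d" using d by simp
    moreover have "1 \<le> a div d" using d a by (simp add: dvd_imp_le Suc_le_eq div_greater_zero_iff)
    moreover have "2 * (a div d) \<le> N div d"
      using d N by (metis div_le_mono div_mult_swap)
    moreover have "a div d * d = a" "N div d * d = N" using d by simp_all
    ultimately show ?thesis using totient_mult_binomial_le[of d "a div d" "N div d" "n div 2"] True N
      by (simp add: X_def div_le_mono)
  qed
  have hA: "(\<Sum>d\<in>A. totient d * ((n div d - 1) choose (a div d - 1))) \<le> (\<Sum>d\<in>A. X)"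
    using n by (intro sum_mono key) (auto simp: A_def)
  have hB: "(\<Sum>q\<in>B. ((n - 1) div q - 1) choose (a div q - 1)) \<le> (\<Sum>d\<in>B. X)"
  proof (rule sum_mono)
    fix q assume "q \<in> B"
    then have q: "q dvd a" "q dvd n - 1" "1 < q" by (auto simp: B_def prime_gt_Suc_0_nat)
    \<comment> \<open>Otherwise \<open>q\<close>, which divides \<open>a\<close>, would divide both
      \<open>n\<close> and \<open>n - 1\<close>.\<close>
    have "n \<noteq> 2 * a" using disj[of q] q by auto
    then have "2 * a \<le> n - 1" using n by linarith
    from key[OF q this] have "totient q * (((n - 1) div q - 1) choose (a div q - 1)) \<le> X" by simp
    moreover have "1 * (((n - 1) div q - 1) choose (a div q - 1)) \<le> totient q * (((n - 1) div q - 1) choose (a div q - 1))"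
      using q by (intro mult_right_mono) (auto simp: Suc_le_eq)
    ultimately show "((n - 1) div q - 1) choose (a div q - 1) \<le> X" by linarith
  qed
  have hC: "(\<Sum>q\<in>C. ((n - 1) div q - 1) choose ((a - 1) div q - 1)) \<le> (\<Sum>d\<in>C. X)"
  proof (rule sum_mono)
    fix q assume "q \<in> C"
    then have "2 \<le> q" by (auto simp: C_def prime_ge_2_nat)
    then have le: "(n - 1) div q \<le> n div 2" "(a - 1) div q \<le> a div 2"
      by (auto intro!: order_trans[OF div_le_mono2[of 2 q]] div_le_mono)
    \<comment> \<open>Both arguments are at most those of \<open>X\<close>, and the lower index of
      \<open>X\<close> is at most half the upper one, so enlarging either argument enlarges the
      coefficient.\<close>
    have "((n - 1) div q - 1) choose ((a - 1) div q - 1) \<le> (n div 2 - 1) choose ((a - 1) div q - 1)"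
      using le by (intro binomial_right_mono) simp
    also have "\<dots> \<le> X" unfolding X_def using le n a by (intro binomial_mono) auto
    finally show "((n - 1) div q - 1) choose ((a - 1) div q - 1) \<le> X" .
  qed
  have "card A + card B = card (A \<union> B)"
    using finAB disj by (subst card_Un_disjoint) (auto simp: A_def B_def prime_gt_Suc_0_nat)
  also have "\<dots> \<le> card {d. d dvd a \<and> 1 < d}" using sub fin by (intro card_mono)
  finally have cAB: "card A + card B \<le> card {d. d dvd a \<and> 1 < d}" .
  have cC: "card C \<le> card {q. prime q \<and> q dvd a - 1}" using sub fin by (intro card_mono)
  have "(a - 1) * ((\<Sum>d\<in>A. totient d * ((n div d - 1) choose (a div d - 1)))
      + (\<Sum>q\<in>B. ((n - 1) div q - 1) choose (a div q - 1)))
    + a * (\<Sum>q\<in>C. ((n - 1) div q - 1) choose ((a - 1) div q - 1))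
    \<le> (a - 1) * (card A * X + card B * X) + a * (card C * X)"
    using hA hB hC unfolding sum_constant of_nat_id by (intro add_mono mult_le_mono2)
  also have "\<dots> = ((a - 1) * (card A + card B) + a * card C) * X" by (simp only: distrib_right mult.assoc)
  also have "\<dots> \<le> ((a - 1) * card {d. d dvd a \<and> 1 < d} + a * card {q. prime q \<and> q dvd a - 1}) * X"
    using cAB cC by (intro mult_le_mono1 add_mono mult_le_mono2)
  also have "\<dots> \<le> (n - 2) choose (a - 2)" unfolding X_def by (rule binomial_ratio_main[OF True n])
  finally show ?thesis unfolding A_def B_def C_def .
next
  case False
  have p2: "{q. prime q \<and> q dvd (2::nat) \<and> q dvd m} = (if 2 dvd m then {2} else {})" for m
    using primes_dvd_imp_eq[of _ "2::nat"] by auto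
  have p3: "{q. prime q \<and> q dvd (3::nat) \<and> q dvd m} = (if 3 dvd m then {3} else {})" for m
    using primes_dvd_imp_eq[of _ "3::nat"] by auto
  have p4: "{q. prime q \<and> q dvd (4::nat) \<and> q dvd m} = (if 2 dvd m then {2} else {})" for m
    using prime_dvd_power[of _ "2::nat" 2] primes_dvd_imp_eq[of _ "2::nat"] by auto
  have p1: "{q. prime q \<and> q dvd (1::nat) \<and> q dvd m} = {}" for m
    by (auto simp: prime_gt_1_nat)
  have "d \<in> {2}" if d: "d dvd 2" "1 < d" for d :: nat
  proof -
    consider "d = 2" using dvd_imp_le[OF d(1)] d(2) by linarith
    then show ?thesis using d by cases auto
  qed
  then have d2: "{d. d dvd (2::nat) \<and> d dvd n \<and> 1 < d} = (if 2 dvd n then {2} else {})"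
    by auto
  have "d \<in> {3}" if d: "d dvd 3" "1 < d" for d :: nat
  proof -
    consider "d = 2" | "d = 3" using dvd_imp_le[OF d(1)] d(2) by linarith
    then show ?thesis using d by cases auto
  qed
  then have d3: "{d. d dvd (3::nat) \<and> d dvd n \<and> 1 < d} = (if 3 dvd n then {3} else {})"
    by auto
  have "d \<in> {2, 4}" if d: "d dvd 4" "1 < d" for d :: nat
  proof -
    consider "d = 2" | "d = 3" | "d = 4" using dvd_imp_le[OF d(1)] d(2) by linarith
    then show ?thesis using d by cases auto
  qed
  then have d4: "{d. d dvd (4::nat) \<and> d dvd n \<and> 1 < d} = (if 4 dvd n then {2, 4} else if 2 dvd n then {2} else {})"
    by (auto intro: dvd_trans[of 2 4])
  have sub: "(2::nat) - 1 = 1" "(3::nat) - 1 = 2" "(4::nat) - 1 = 3" by simp_all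
  consider "a = 2" | "a = 3" | "a = 4" using a False by linarith
  then show ?thesis
  proof cases
    case 1
    show ?thesis using n unfolding 1 sub d2 p1 p2 by auto
  next
    case 2
    define A where "A = (if 3 dvd n then 2 else (0::nat))"
    define B where "B = (if 3 dvd n - 1 then 1 else (0::nat))"
    define C where "C = (if 2 dvd n - 1 then 1 else (0::nat))"
    have "2 * (A + B) + 3 * C \<le> n - 2"
    proof (cases "n \<le> 8")
      case True
      then have "n = 6 \<or> n = 7 \<or> n = 8" using n 2 by linarith
      then show ?thesis by (auto simp: A_def B_def C_def)
    next
      case False
      have "\<not> (3 dvd n \<and> 3 dvd n - 1)" using False by presburger
      then have "A + B \<le> 2" by (auto simp: A_def B_def)
      moreover have "C \<le> 1" by (auto simp: C_def)
      moreover have "7 \<le> n - 2" using False by simp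
      ultimately show ?thesis by (simp add: distrib_left)
    qed
    then have "2 * (A + B) + 3 * C \<le> (n - 2) choose (3 - 2)" by simp
    moreover have "(\<Sum>d\<in>(if 3 dvd n then {3} else {}). totient d * ((n div d - 1) choose (3 div d - 1))) = A"
      by (auto simp: A_def totient_prime)
    moreover have "(\<Sum>q\<in>(if 3 dvd n - 1 then {3} else {}). ((n - 1) div q - 1) choose (3 div q - 1)) = B"
      by (auto simp: B_def)
    moreover have "(\<Sum>q\<in>(if 2 dvd n - 1 then {2} else {}). ((n - 1) div q - 1) choose (2 div q - 1)) = C"
      by (auto simp: C_def)
    ultimately show ?thesis unfolding 2 sub d3 p3 p2 by simp
  next
    case 3
    have b: "2 * ((n - 2) choose 2) = (n - 2) * (n - 3)"
      using n 3 times_binomial_minus1_eq[of 2 "n - 2"] by (simp add: numeral_eq_Suc)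
    define A where "A = (if 4 dvd n then n div 2 + 1 else if 2 dvd n then n div 2 - 1 else 0)"
    define B where "B = (if 2 dvd n - 1 then (n - 1) div 2 - 1 else 0)"
    define C where "C = (if 3 dvd n - 1 then 1 else (0::nat))"
    have "6 * (A + B) + 8 * C \<le> (n - 2) * (n - 3)"
    proof (cases "n \<le> 9")
      case True
      then have "n = 8 \<or> n = 9" using n 3 by linarith
      then show ?thesis by (auto simp: A_def B_def C_def)
    next
      case False
      then have "8 \<le> n - 2" "7 \<le> n - 3" by auto
      have "2 * (A + B) \<le> n + 2"
      proof -
        have "\<not> (2 dvd n \<and> 2 dvd n - 1)" using False by presburger
        moreover have "4 dvd n \<Longrightarrow> 2 dvd n" by (rule dvd_trans[of _ 4]) auto
        ultimately show ?thesis unfolding A_def B_def by auto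
      qed
      moreover have "C \<le> 1" by (simp add: C_def)
      ultimately have "6 * (A + B) + 8 * C \<le> 7 * (n - 2)" using False by (simp add: distrib_left)
      also have "\<dots> \<le> (n - 2) * (n - 3)" using \<open>7 \<le> n - 3\<close> by (subst mult.commute) (rule mult_le_mono2)
      finally show ?thesis .
    qed
    then have "3 * (A + B) + 4 * C \<le> (n - 2) choose (4 - 2)" using b by simp
    moreover have "(\<Sum>d\<in>(if 4 dvd n then {2, 4} else if 2 dvd n then {2} else {}).
        totient d * ((n div d - 1) choose (4 div d - 1))) = A"
      using n 3 by (auto simp: A_def)
    moreover have "(\<Sum>q\<in>(if 2 dvd n - 1 then {2} else {}). ((n - 1) div q - 1) choose (4 div q - 1)) = B"
      by (auto simp: B_def)
    moreover have "(\<Sum>q\<in>(if 3 dvd n - 1 then {3} else {}). ((n - 1) div q - 1) choose (3 div q - 1)) = C"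
      by (auto simp: C_def)
    ultimately show ?thesis unfolding 3 sub d4 p4 p3 by simp
  qed
qed

subsection \<open>Imprimitive words\<close>

text \<open>The empty word counts as imprimitive, so that erasing letters preserves imprimitivity.\<close>

definition primitive :: "'a list \<Rightarrow> bool" where
  "primitive w \<longleftrightarrow> w \<noteq> [] \<and> (\<forall>j. 0 < j \<and> j < length w \<longrightarrow> rotate j w \<noteq> w)"

lemma rotate_fixed_mult: "rotate j w = w \<Longrightarrow> rotate (j * i) w = w"
proof (induction i)
  case (Suc i)
  have "rotate (j * Suc i) w = rotate j (rotate (j * i) w)" by (simp add: rotate_rotate)
  then show ?case using Suc by simp
qed simp

text \<open>By Bezout the gcd is a multiple of \<open>j\<close> minus a multiple of the length, and
  rotating by the length changes nothing.\<close>

lemma rotate_fixed_gcd: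
  assumes "rotate j w = w" shows "rotate (gcd j (length w)) w = w"
proof (cases "j = 0")
  case False
  then obtain x y where xy: "j * x = length w * y + gcd j (length w)" using bezout_nat by blast
  have "w = rotate (j * x) w" using rotate_fixed_mult[OF assms] by simp
  also have "\<dots> = rotate (gcd j (length w)) (rotate (length w * y) w)"
    unfolding xy add.commute[of "length w * y"] by (rule rotate_rotate[symmetric])
  also have "rotate (length w * y) w = w" by (rule rotate_id) simp
  finally show ?thesis by simp
qed simp

text \<open>Comparing prefixes of \<open>u @ v\<close> and \<open>v @ u\<close> shows that
  \<open>v\<close> starts with \<open>u\<close>; after cancelling, the shorter remainder still
  commutes with \<open>u\<close>.\<close>

lemma commuting_append_eq_concat_replicate:
  assumes "u @ v = v @ u" "length v = k * length u"
  shows "v = concat (replicate k u)"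
  using assms
proof (induction k arbitrary: v)
  case (Suc k)
  have "u = take (length u) (u @ v)" by simp
  also have "\<dots> = take (length u) (v @ u)" by (simp only: Suc.prems(1))
  also have "\<dots> = take (length u) v" using Suc.prems(2) by simp
  finally have "u = take (length u) v" .
  then obtain v' where v: "v = u @ v'" by (metis append_take_drop_id)
  then have "v' = concat (replicate k u)" using Suc.prems by (intro Suc.IH) auto
  then show ?case using v by simp
qed simp

lemma rotate_fixed_eq_concat_replicate:
  assumes "rotate g w = w" "length w = d * g"
  shows "w = concat (replicate d (take g w))"
proof (cases "d = 0 \<or> g = 0")
  case False
  define u v where "u = take g w" and "v = drop g w"
  have len: "length u = g" "length v = (d - 1) * g"
    using False assms(2) by (auto simp: u_def v_def algebra_simps)
  have w: "w = u @ v" by (simp add: u_def v_def)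
  have "rotate (length u) (u @ v) = v @ u" by (rule rotate_append)
  then have "u @ v = v @ u" using assms(1) w len by simp
  then have "v = concat (replicate (d - 1) u)"
    using len by (intro commuting_append_eq_concat_replicate) auto
  then have "w = concat (replicate (Suc (d - 1)) u)" using w by simp
  moreover have "Suc (d - 1) = d" using False by simp
  ultimately show ?thesis by (simp only: u_def)
qed (use assms in auto)

lemma count_list_concat_replicate: "count_list (concat (replicate d u)) x = d * count_list u x"
  by (induction d) auto

text \<open>If a proper divisor $g$ of the length fixes the word, take a prime $q$ dividing the
  cofactor: the length over $q$ is a multiple of $g$. Prime exponents thus suffice when imprimitive
  words are counted.\<close>

lemma imprimitive_prime_rotation:
  assumes "\<not> primitive w"
  shows "\<exists>q. prime q \<and> q dvd length w \<and> rotate (length w div q) w = w"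
proof (cases "w = []")
  case True
  \<comment> \<open>Every prime divides the length 0; 2 is an arbitrary choice.\<close>
  then show ?thesis by (auto intro: exI[of _ 2])
next
  case False
  then obtain j where j: "0 < j" "j < length w" "rotate j w = w" using assms by (auto simp: primitive_def)
  define g where "g = gcd j (length w)"
  have g: "rotate g w = w" "g dvd length w" "g < length w" "0 < g"
    using j rotate_fixed_gcd[OF j(3)] by (auto simp: g_def intro: le_less_trans[OF gcd_le1_nat])
  then obtain e where e: "length w = g * e" by (elim dvdE)
  have "e \<noteq> 1" using e g by auto
  then obtain q where q: "prime q" "q dvd e" using prime_factor_nat by blast
  then obtain f where f: "e = q * f" by (elim dvdE)
  have "length w div q = g * f" using e f prime_gt_0_nat[OF q(1)] by simp
  then show ?thesis using q e f rotate_fixed_mult[OF g(1), of f] by (intro exI[of _ q]) auto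
qed

text \<open>Being a proper power is visibly preserved by \<open>map\<close> and
  \<open>filter\<close>. The root \<open>u\<close> may be empty, which accounts for the empty
  word.\<close>

lemma imprimitive_iff_power:
  "\<not> primitive w \<longleftrightarrow> (\<exists>d u. 2 \<le> d \<and> w = concat (replicate d u))"
proof
  assume "\<not> primitive w"
  then obtain q where q: "prime q" "q dvd length w" "rotate (length w div q) w = w"
    using imprimitive_prime_rotation by blast
  then have "w = concat (replicate q (take (length w div q) w))"
    by (intro rotate_fixed_eq_concat_replicate) auto
  then show "\<exists>d u. 2 \<le> d \<and> w = concat (replicate d u)" using prime_ge_2_nat[OF q(1)] by blast
next
  assume "\<exists>d u. 2 \<le> d \<and> w = concat (replicate d u)"
  then obtain d u where "2 \<le> d" "w = concat (replicate d u)" by blast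
  then obtain c where w: "w = concat (replicate (Suc (Suc c)) u)"
    by (metis add_2_eq_Suc le_Suc_ex)
  have "rotate (length u) w = concat (replicate (Suc c) u) @ u"
    unfolding w using rotate_append[of u "concat (replicate (Suc c) u)"] by simp
  also have "\<dots> = concat (replicate (Suc c) u @ [u])" by simp
  also have "\<dots> = w" unfolding w by (simp only: replicate_append_same replicate_Suc[of "Suc c"])
  finally have "rotate (length u) w = w" .
  moreover have "length u < length w" "0 < length u" if "w \<noteq> []" using that w by auto
  ultimately show "\<not> primitive w" unfolding primitive_def by blast
qed

lemma imprimitive_map: "\<not> primitive w \<Longrightarrow> \<not> primitive (map f w)"
  unfolding imprimitive_iff_power by (metis map_concat map_replicate)

lemma imprimitive_filter: "\<not> primitive w \<Longrightarrow> \<not> primitive (filter P w)"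
  unfolding imprimitive_iff_power by (metis filter_concat map_replicate)

text \<open>If a shift $0 < j < |w|$ fixes the word $w$, position $j$ carries \<open>x\<close> like
  position 0, so $j$ lies in the leading block; but then the last letter equals the one at $j - 1$,
  again \<open>x\<close>, although the word ends in a letter of \<open>v\<close>.\<close>

lemma primitive_block_append:
  assumes "0 < c" "v \<noteq> []" "x \<notin> set v"
  shows "primitive (replicate c x @ v)"
proof -
  define w where "w = replicate c x @ v"
  have nth: "w ! i = x \<longleftrightarrow> i < c" if "i < length w" for i
    using that assms(3) nth_mem[of "i - c" v] by (auto simp: w_def nth_append)
  have "w \<noteq> []" "c < length w" using assms by (auto simp: w_def)
  moreover have False if j: "0 < j" "j < length w" and rot: "rotate j w = w" for j
  proof -
    have pos: "0 < length w" using j by linarith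
    have cyc: "w ! i = w ! ((j + i) mod length w)" if "i < length w" for i
      using nth_rotate[OF that, of j] rot by simp
    have "w ! j = w ! 0" using cyc[OF pos] j by simp
    then have "j < c" using nth[OF pos] nth[OF j(2)] assms(1) by simp
    have "w ! (length w - 1) = w ! (j - 1)"
    proof -
      have "j + (length w - 1) = (j - 1) + length w" using j by simp
      then have "(j + (length w - 1)) mod length w = j - 1" using j by (simp only: mod_add_self2) simp
      then show ?thesis using cyc[of "length w - 1"] j by simp
    qed
    then have "length w - 1 < c" using nth[of "length w - 1"] nth[of "j - 1"] \<open>j < c\<close> j by auto
    then show False using \<open>c < length w\<close> by simp
  qed
  ultimately show ?thesis unfolding primitive_def w_def[symmetric] by blast
qed

section \<open>Counting periodic binary words\<close>

definition bool_words :: "nat \<Rightarrow> nat \<Rightarrow> bool list set" where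
  "bool_words n a = {w. length w = n \<and> count_list w True = a}"

lemma finite_bool_words [simp]: "finite (bool_words n a)"
  unfolding bool_words_def
  by (rule finite_subset[OF _ finite_lists_length_eq[of UNIV n]]) auto

lemma card_bool_words: "card (bool_words n a) = n choose a"
proof (induction n arbitrary: a)
  case 0
  have "bool_words 0 a = (if a = 0 then {[]} else {})" by (auto simp: bool_words_def)
  then show ?case by (cases a) auto
next
  case (Suc n)
  show ?case
  proof (cases a)
    case 0
    have "bool_words (Suc n) 0 = Cons False ` bool_words n 0"
      by (auto simp: bool_words_def length_Suc_conv image_iff split: if_splits)
    then show ?thesis using Suc[of 0] 0 by (simp add: card_image)
  next
    case (Suc a')
    have "bool_words (Suc n) a = Cons True ` bool_words n a' \<union> Cons False ` bool_words n a"
      using Suc by (auto simp: bool_words_def length_Suc_conv image_iff split: if_splits)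
    moreover have "card (Cons True ` bool_words n a' \<union> Cons False ` bool_words n a)
        = card (Cons True ` bool_words n a') + card (Cons False ` bool_words n a)"
      by (intro card_Un_disjoint) auto
    ultimately show ?thesis using Suc Suc.IH by (simp add: card_image)
  qed
qed

text \<open>A fixed word is the $d$-th power of its prefix of length \<open>n div d\<close>, and the
  $d$ copies share the marks equally.\<close>

lemma card_bool_words_fixed_le:
  assumes "0 < n" "d dvd n"
  shows "card {w \<in> bool_words n a. rotate (n div d) w = w}
    \<le> (if d dvd a then (n div d) choose (a div d) else 0)"
proof -
  define g where "g = n div d"
  define F where "F = {w \<in> bool_words n a. rotate g w = w}"
  have n: "n = d * g" "0 < d" using assms by (auto simp: g_def dvd_pos_nat)
  have F: "w = concat (replicate d (take g w))" "length w = n" "count_list w True = a" if "w \<in> F" for w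
    using that n by (auto simp: F_def bool_words_def intro!: rotate_fixed_eq_concat_replicate)
  have cnt: "a = d * count_list (take g w) True" if "w \<in> F" for w
  proof -
    have "a = count_list (concat (replicate d (take g w))) True" using F[OF that] by metis
    then show ?thesis by (simp only: count_list_concat_replicate)
  qed
  have "card F \<le> card (bool_words g (a div d))"
  proof (rule card_inj_on_le)
    show "inj_on (take g) F" using F(1) by (intro inj_onI) metis
    show "take g ` F \<subseteq> bool_words g (a div d)"
    proof safe
      fix w assume w: "w \<in> F"
      have "g \<le> n" using n by simp
      then show "take g w \<in> bool_words g (a div d)"
        using cnt[OF w] F(2)[OF w] n by (auto simp: bool_words_def)
    qed
  qed simp
  moreover have "d dvd a" if "F \<noteq> {}" using cnt that by (auto intro: dvdI)
  ultimately show ?thesis unfolding F_def g_def by (auto simp: card_bool_words)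
qed

lemma sum_fixed_bool_words_le:
  assumes "0 < n" "0 < a"
  shows "(\<Sum>j\<in>{0<..<n}. card {w \<in> bool_words n a. rotate j w = w})
    \<le> (\<Sum>d | d dvd a \<and> d dvd n \<and> 1 < d. totient d * ((n div d) choose (a div d)))"
proof -
  define f where "f d = (if d dvd a then (n div d) choose (a div d) else 0)" for d
  define T where "T = {d. d dvd n \<and> 1 < d}"
  have T: "finite T" unfolding T_def using assms by (auto intro: finite_subset[OF _ finite_divisors_nat[of n]])
  have ord: "n div gcd j n \<in> T" "n div (n div gcd j n) = gcd j n" if "j \<in> {0<..<n}" for j
  proof -
    define e where "e = n div gcd j n"
    have lt: "gcd j n < n" using that by (auto intro: le_less_trans[OF gcd_le1_nat])
    have n: "n = gcd j n * e" by (simp add: e_def)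
    have "e \<noteq> 0" "e \<noteq> 1" using n lt by (metis mult_0_right not_less0, metis mult_1_right less_irrefl)
    moreover have "e dvd n" using n by (metis dvd_triv_right)
    ultimately show "n div gcd j n \<in> T" by (simp add: T_def flip: e_def)
    show "n div (n div gcd j n) = gcd j n"
      using n \<open>e \<noteq> 0\<close> nonzero_mult_div_cancel_right[of e "gcd j n"] by (simp flip: e_def)
  qed
  have "(\<Sum>j\<in>{0<..<n}. card {w \<in> bool_words n a. rotate j w = w}) \<le> (\<Sum>j\<in>{0<..<n}. f (n div gcd j n))"
  proof (rule sum_mono)
    fix j assume j: "j \<in> {0<..<n}"
    have "{w \<in> bool_words n a. rotate j w = w} \<subseteq> {w \<in> bool_words n a. rotate (n div (n div gcd j n)) w = w}"
      using rotate_fixed_gcd[of j] ord(2)[OF j] by (auto simp: bool_words_def)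
    then have "card {w \<in> bool_words n a. rotate j w = w} \<le> card {w \<in> bool_words n a. rotate (n div (n div gcd j n)) w = w}"
      by (intro card_mono) auto
    also have "\<dots> \<le> f (n div gcd j n)"
      unfolding f_def using ord(1)[OF j] assms by (intro card_bool_words_fixed_le) (auto simp: T_def)
    finally show "card {w \<in> bool_words n a. rotate j w = w} \<le> f (n div gcd j n)" .
  qed
  also have "\<dots> = (\<Sum>d\<in>T. \<Sum>j\<in>{j\<in>{0<..<n}. n div gcd j n = d}. f (n div gcd j n))"
    using T ord(1) by (intro sum.group[symmetric]) auto
  also have "\<dots> = (\<Sum>d\<in>T. card {j\<in>{0<..<n}. n div gcd j n = d} * f d)" by (intro sum.cong) auto
  also have "\<dots> \<le> (\<Sum>d\<in>T. totient d * f d)"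
  proof (intro sum_mono mult_right_mono)
    fix d assume d: "d \<in> T"
    have "{j\<in>{0<..<n}. n div gcd j n = d} \<subseteq> {j\<in>{0<..n}. gcd j n = n div d}" using ord(2) by auto
    then have "card {j\<in>{0<..<n}. n div gcd j n = d} \<le> card {j\<in>{0<..n}. gcd j n = n div d}"
      by (intro card_mono) auto
    also have "\<dots> = totient (n div (n div d))"
      using d assms by (intro card_gcd_eq_totient) (auto simp: T_def)
    also have "n div (n div d) = d" using d assms by (auto simp: T_def elim: dvdE)
    finally show "card {j\<in>{0<..<n}. n div gcd j n = d} \<le> totient d" .
  qed auto
  also have "\<dots> = (\<Sum>d | d \<in> T \<and> d dvd a. totient d * ((n div d) choose (a div d)))"
    using T by (subst sum.inter_filter) (auto intro!: sum.cong simp: f_def)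
  also have "{d. d \<in> T \<and> d dvd a} = {d. d dvd a \<and> d dvd n \<and> 1 < d}" by (auto simp: T_def)
  finally show ?thesis .
qed

text \<open>Union bound over the prime exponents.\<close>

lemma card_imprimitive_bool_words_le:
  assumes "0 < n"
  shows "card {w \<in> bool_words n a. \<not> primitive w}
    \<le> (\<Sum>q | prime q \<and> q dvd a \<and> q dvd n. (n div q) choose (a div q))"
proof -
  define Q where "Q = {q. prime q \<and> q dvd n}"
  have Q: "finite Q" unfolding Q_def using assms by (auto intro: finite_subset[OF _ finite_divisors_nat[of n]])
  have "{w \<in> bool_words n a. \<not> primitive w} \<subseteq> (\<Union>q\<in>Q. {w \<in> bool_words n a. rotate (n div q) w = w})"
  proof
    fix w assume w: "w \<in> {w \<in> bool_words n a. \<not> primitive w}"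
    then obtain q where "prime q" "q dvd length w" "rotate (length w div q) w = w"
      using imprimitive_prime_rotation by blast
    moreover have "length w = n" using w by (simp add: bool_words_def)
    ultimately have "q \<in> Q" "w \<in> {w \<in> bool_words n a. rotate (n div q) w = w}" using w by (simp_all add: Q_def)
    then show "w \<in> (\<Union>q\<in>Q. {w \<in> bool_words n a. rotate (n div q) w = w})" by (rule UN_I)
  qed
  then have "card {w \<in> bool_words n a. \<not> primitive w} \<le> card (\<Union>q\<in>Q. {w \<in> bool_words n a. rotate (n div q) w = w})"
    using Q by (intro card_mono) auto
  also have "\<dots> \<le> (\<Sum>q\<in>Q. card {w \<in> bool_words n a. rotate (n div q) w = w})"
    using Q by (rule card_UN_le)
  also have "\<dots> \<le> (\<Sum>q\<in>Q. if q dvd a then (n div q) choose (a div q) else 0)"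
    using assms by (intro sum_mono card_bool_words_fixed_le) (auto simp: Q_def)
  also have "\<dots> = (\<Sum>q | q \<in> Q \<and> q dvd a. (n div q) choose (a div q))"
    using Q by (rule sum.inter_filter[symmetric])
  also have "{q. q \<in> Q \<and> q dvd a} = {q. prime q \<and> q dvd a \<and> q dvd n}" by (auto simp: Q_def)
  finally show ?thesis .
qed

text \<open>The absorption identity at $n/d$ and $a/d$, multiplied by $d$.\<close>

lemma binomial_absorb_div:
  assumes "0 < d" "d dvd n" "d dvd a" "0 < a"
  shows "a * ((n div d) choose (a div d)) = n * ((n div d - 1) choose (a div d - 1))"
proof -
  have "0 < a div d" using assms by (simp add: div_greater_zero_iff dvd_imp_le)
  from times_binomial_minus1_eq[OF this, of "n div d"]
  have "d * (a div d) * ((n div d) choose (a div d)) = d * (n div d) * ((n div d - 1) choose (a div d - 1))"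
    by (simp only: mult.assoc)
  then show ?thesis using assms by simp
qed

text \<open>The two last terms on the left are the imprimitive tails left by an unmarked and by a
  marked first letter. Multiplying by $a(a-1)$ and absorbing produces the factor $n(n-1)$ on both
  sides; what remains is \<open>binomial_divisor_sum_le\<close>.\<close>

lemma bool_words_inequality:
  assumes a: "1 \<le> a" and n: "2 * a \<le> n"
  shows "(n - 1) * (\<Sum>j\<in>{0<..<n}. card {w \<in> bool_words n a. rotate j w = w})
    + n * card {w \<in> bool_words (n - 1) a. \<not> primitive w}
    + n * card {w \<in> bool_words (n - 1) (a - 1). \<not> primitive w} \<le> n choose a"
proof (cases "a = 1")
  case True
  have Q: "(\<Sum>j\<in>{0<..<n}. card {w \<in> bool_words n a. rotate j w = w}) = 0"
  proof -
    have "{d. d dvd a \<and> d dvd n \<and> 1 < d} = {}" using True by auto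
    then show ?thesis using sum_fixed_bool_words_le[of n a] n a by (simp only: sum.empty) simp
  qed
  have R1: "card {w \<in> bool_words (n - 1) a. \<not> primitive w} = 0"
  proof -
    have "{q. prime q \<and> q dvd a \<and> q dvd n - 1} = {}" using True by (auto simp: prime_gt_1_nat)
    then show ?thesis using card_imprimitive_bool_words_le[of "n - 1" a] n a by (simp only: sum.empty) simp
  qed
  have "card {w \<in> bool_words (n - 1) (a - 1). \<not> primitive w} \<le> card (bool_words (n - 1) (a - 1))"
    by (intro card_mono) auto
  then have "card {w \<in> bool_words (n - 1) (a - 1). \<not> primitive w} \<le> 1"
    using True by (simp add: card_bool_words)
  then have "n * card {w \<in> bool_words (n - 1) (a - 1). \<not> primitive w} \<le> n * 1"
    by (rule mult_le_mono2)
  then show ?thesis unfolding Q R1 using True by simp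
next
  case False
  then have a2: "2 \<le> a" using a by simp
  define SA where "SA = (\<Sum>d | d dvd a \<and> d dvd n \<and> 1 < d. totient d * ((n div d - 1) choose (a div d - 1)))"
  define SB where "SB = (\<Sum>q | prime q \<and> q dvd a \<and> q dvd n - 1. ((n - 1) div q - 1) choose (a div q - 1))"
  define SC where "SC = (\<Sum>q | prime q \<and> q dvd a - 1 \<and> q dvd n - 1. ((n - 1) div q - 1) choose ((a - 1) div q - 1))"
  define Q where "Q = (\<Sum>j\<in>{0<..<n}. card {w \<in> bool_words n a. rotate j w = w})"
  define R1 where "R1 = card {w \<in> bool_words (n - 1) a. \<not> primitive w}"
  define R2 where "R2 = card {w \<in> bool_words (n - 1) (a - 1). \<not> primitive w}"
  have "a * Q \<le> a * (\<Sum>d | d dvd a \<and> d dvd n \<and> 1 < d. totient d * ((n div d) choose (a div d)))"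
    unfolding Q_def using n a2 by (intro mult_le_mono2 sum_fixed_bool_words_le) auto
  also have "\<dots> = n * SA"
    unfolding SA_def sum_distrib_left using a2
    by (intro sum.cong refl) (simp add: mult.left_commute[of _ "totient _"] binomial_absorb_div del: One_nat_def)
  finally have Q: "a * Q \<le> n * SA" .
  have "a * R1 \<le> a * (\<Sum>q | prime q \<and> q dvd a \<and> q dvd n - 1. ((n - 1) div q) choose (a div q))"
    unfolding R1_def using n a2 by (intro mult_le_mono2 card_imprimitive_bool_words_le) auto
  also have "\<dots> = (n - 1) * SB"
    unfolding SB_def sum_distrib_left using a2
    by (intro sum.cong refl) (simp add: binomial_absorb_div prime_gt_0_nat del: One_nat_def)
  finally have R1: "a * R1 \<le> (n - 1) * SB" .
  have "(a - 1) * R2 \<le> (a - 1) * (\<Sum>q | prime q \<and> q dvd a - 1 \<and> q dvd n - 1. ((n - 1) div q) choose ((a - 1) div q))"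
    unfolding R2_def using n a2 by (intro mult_le_mono2 card_imprimitive_bool_words_le) auto
  also have "\<dots> = (n - 1) * SC"
    unfolding SC_def sum_distrib_left using a2
    by (intro sum.cong refl) (simp add: binomial_absorb_div prime_gt_0_nat del: One_nat_def)
  finally have R2: "(a - 1) * R2 \<le> (n - 1) * SC" .
  have main: "(a - 1) * (SA + SB) + a * SC \<le> (n - 2) choose (a - 2)"
    unfolding SA_def SB_def SC_def by (rule binomial_divisor_sum_le[OF a2 n])
  have "a * ((a - 1) * (n choose a)) = (a - 1) * (a * (n choose a))" by (simp only: mult.left_commute)
  also have "\<dots> = n * ((a - 1) * ((n - 1) choose (a - 1)))"
    using a2 times_binomial_minus1_eq[of a n] by (simp only: mult.left_commute)
  also have "(a - 1) * ((n - 1) choose (a - 1)) = (n - 1) * ((n - 2) choose (a - 2))"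
    using a2 times_binomial_minus1_eq[of "a - 1" "n - 1"] by (simp add: numeral_2_eq_2)
  finally have C: "a * ((a - 1) * (n choose a)) = n * ((n - 1) * ((n - 2) choose (a - 2)))" .
  have "a * ((a - 1) * ((n - 1) * Q + n * R1 + n * R2))
      = (a - 1) * (n - 1) * (a * Q) + (a - 1) * n * (a * R1) + a * n * ((a - 1) * R2)"
    by (simp only: distrib_left ac_simps)
  also have "\<dots> \<le> (a - 1) * (n - 1) * (n * SA) + (a - 1) * n * ((n - 1) * SB) + a * n * ((n - 1) * SC)"
    using Q R1 R2 by (intro add_mono mult_le_mono2)
  also have "\<dots> = n * ((n - 1) * ((a - 1) * (SA + SB) + a * SC))"
    by (simp only: distrib_left ac_simps)
  also have "\<dots> \<le> n * ((n - 1) * ((n - 2) choose (a - 2)))"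
    using main by (intro mult_le_mono2)
  also have "\<dots> = a * ((a - 1) * (n choose a))" by (rule C[symmetric])
  finally have "(n - 1) * Q + n * R1 + n * R2 \<le> n choose a" using a2 by simp
  then show ?thesis unfolding Q_def R1_def R2_def .
qed

subsection \<open>Words of given content\<close>

definition content_words :: "nat \<Rightarrow> (nat \<Rightarrow> nat) \<Rightarrow> nat list set" where
  "content_words k m = {w \<in> words k. has_content k m w}"

lemma length_content_words: "w \<in> content_words k m \<Longrightarrow> length w = (\<Sum>i<k. m i)"
proof -
  assume w: "w \<in> content_words k m"
  then have "(\<Sum>i<k. m i) = sum (count_list w) {..<k}"
    by (intro sum.cong) (auto simp: content_words_def has_content_def)
  also have "\<dots> = length w" using w by (intro sum_count_set) (auto simp: content_words_def words_def)
  finally show ?thesis by simp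
qed

lemma finite_content_words [simp]: "finite (content_words k m)"
proof (rule finite_subset)
  show "content_words k m \<subseteq> {w. set w \<subseteq> {..<k} \<and> length w = (\<Sum>i<k. m i)}"
  proof
    fix w assume w: "w \<in> content_words k m"
    then show "w \<in> {w. set w \<subseteq> {..<k} \<and> length w = (\<Sum>i<k. m i)}"
      using length_content_words[OF w] by (simp add: content_words_def words_def)
  qed
qed (simp add: finite_lists_length_eq)

lemma count_list_rotate [simp]: "count_list (rotate j w) x = count_list w x"
proof (induction j)
  case (Suc j)
  have "count_list (rotate1 v) x = count_list v x" for v by (cases v) auto
  then show ?case using Suc by simp
qed simp

lemma rotate_in_content_words [simp]: "rotate j w \<in> content_words k m \<longleftrightarrow> w \<in> content_words k m"
  by (simp add: content_words_def words_def has_content_def)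

lemma content_words_nonempty: "\<exists>w. w \<in> content_words k m"
proof
  have "count_list (concat (map (\<lambda>i. replicate (m i) i) [0..<k])) x = (if x < k then m x else 0)" for x
  proof (induction k)
    case (Suc k)
    have "count_list (replicate c y) x = (if x = y then c else 0)" for c y
      by (induction c) auto
    then show ?case using Suc by auto
  qed simp
  then show "concat (map (\<lambda>i. replicate (m i) i) [0..<k]) \<in> content_words k m"
    by (auto simp: content_words_def words_def has_content_def)
qed

section \<open>Rotation classes, Lyndon words and necklaces\<close>

lemma rotate_inverse: "rotate (length w - j mod length w) (rotate j w) = w"
proof (cases "w = []")
  case False
  then have "rotate (length w - j mod length w) (rotate j w) = rotate (length w - j mod length w) (rotate (j mod length w) w)"
    by (metis rotate_conv_mod)
  also have "\<dots> = rotate (length w) w" using False by (simp add: rotate_rotate)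
  finally show ?thesis by simp
qed simp

lemma primitive_rotate:
  assumes "primitive w" shows "primitive (rotate j w)"
  unfolding primitive_def
proof (intro conjI allI impI notI)
  fix i assume i: "0 < i \<and> i < length (rotate j w)" and fixed: "rotate i (rotate j w) = rotate j w"
  let ?l = "length w - j mod length w"
  have "rotate i w = rotate i (rotate ?l (rotate j w))" by (simp only: rotate_inverse)
  also have "\<dots> = rotate ?l (rotate i (rotate j w))" by (simp add: rotate_rotate add_ac)
  also have "\<dots> = w" by (simp only: fixed rotate_inverse)
  finally show False using assms i by (auto simp: primitive_def)
qed (use assms in \<open>auto simp: primitive_def\<close>)

lemma rotation_class_rotate: "rotation_class (rotate j w) = rotation_class w"
proof -
  have sub: "rotation_class (rotate j w) \<subseteq> rotation_class w" for j w
    by (auto simp: rotation_class_def rotate_rotate)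
  show ?thesis using sub[of j w] sub[of "length w - j mod length w" "rotate j w"]
    by (auto simp: rotate_inverse)
qed

lemma rotation_class_eq: "rotation_class w = (\<lambda>j. rotate j w) ` {..length w}"
proof -
  have "rotate j w \<in> (\<lambda>j. rotate j w) ` {..length w}" for j
    by (cases "w = []") (auto intro!: image_eqI[of _ _ "j mod length w"] simp: less_imp_le simp flip: rotate_conv_mod)
  then show ?thesis by (auto simp: rotation_class_def)
qed

text \<open>The least rotation is a necklace, and primitivity makes its inequalities strict.\<close>

lemma primitive_rotation_of_lyndon:
  assumes "primitive w"
  shows "\<exists>v i. lyndon v \<and> i < length w \<and> w = rotate i v"
proof -
  define v where "v = Min (rotation_class w)"
  have fin: "finite (rotation_class w)" by (simp add: rotation_class_eq)
  have "w \<in> rotation_class w" unfolding rotation_class_def by (auto intro: exI[of _ 0])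
  then have "v \<in> rotation_class w" unfolding v_def using fin by (intro Min_in) auto
  then obtain j where j: "v = rotate j w" by (auto simp: rotation_class_def)
  have min: "v \<le> u" if "u \<in> rotation_class v" for u
    using that fin unfolding j rotation_class_rotate unfolding j[symmetric] v_def by simp
  have prim: "primitive v" unfolding j by (rule primitive_rotate[OF assms])
  have "lyndon v" unfolding lyndon_def necklace_def
  proof (intro conjI allI impI ballI)
    fix i assume "0 < i \<and> i < length v"
    then have "rotate i v \<noteq> v" using prim by (simp add: primitive_def)
    moreover have "v \<le> rotate i v" by (rule min) (auto simp: rotation_class_def)
    ultimately show "v < rotate i v" by simp
  qed (use prim min in \<open>auto simp: primitive_def\<close>)
  moreover have "w = rotate (length w - j mod length w) v" unfolding j by (rule rotate_inverse[symmetric])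
  then have "w = rotate ((length w - j mod length w) mod length v) v" by (metis rotate_conv_mod)
  moreover have "(length w - j mod length w) mod length v < length w"
    using assms by (simp add: j primitive_def)
  ultimately show ?thesis by blast
qed

text \<open>The pairs of a Lyndon word and a shift below the length reach every primitive
  word.\<close>

lemma card_primitive_le:
  "card {w \<in> content_words k m. primitive w} \<le> (\<Sum>i<k. m i) * num_lyndon k m"
proof -
  let ?L = "{w \<in> words k. lyndon w \<and> has_content k m w}" and ?S = "\<Sum>i<k. m i"
  have L: "?L = {w \<in> content_words k m. lyndon w}" by (auto simp: content_words_def)
  have "{w \<in> content_words k m. primitive w} \<subseteq> (\<lambda>(v, i). rotate i v) ` (?L \<times> {..<?S})"
  proof
    fix w assume w: "w \<in> {w \<in> content_words k m. primitive w}"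
    then obtain v i where vi: "lyndon v" "i < length w" "w = rotate i v"
      using primitive_rotation_of_lyndon by blast
    then have "(v, i) \<in> ?L \<times> {..<?S}" unfolding L using w length_content_words[of w k m] by auto
    then show "w \<in> (\<lambda>(v, i). rotate i v) ` (?L \<times> {..<?S})" using vi by force
  qed
  then have "card {w \<in> content_words k m. primitive w} \<le> card ((\<lambda>(v, i). rotate i v) ` (?L \<times> {..<?S}))"
    unfolding L by (intro card_mono) auto
  also have "\<dots> \<le> card (?L \<times> {..<?S})" unfolding L by (intro card_image_le) auto
  finally show ?thesis by (simp add: num_lyndon_def card_cartesian_product mult.commute)
qed

text \<open>The shifts taking \<open>v\<close> to \<open>w\<close> form a coset of the stabiliser:
  adding a fixed shift \<open>c\<close> from \<open>w\<close> back to \<open>v\<close> maps them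
  injectively to shifts fixing \<open>w\<close>.\<close>

lemma card_rotations_to_le:
  assumes "w = rotate i0 v" "length v = S" "0 < S"
  shows "card {i\<in>{..<S}. rotate i v = w} \<le> card {j\<in>{..<S}. rotate j w = w}"
proof -
  define c where "c = S - i0 mod S"
  have c: "rotate c w = v" unfolding c_def assms(2)[symmetric] assms(1) by (rule rotate_inverse)
  have len: "length w = S" using assms by simp
  have "(\<lambda>i. (i + c) mod S) ` {i\<in>{..<S}. rotate i v = w} \<subseteq> {j\<in>{..<S}. rotate j w = w}"
  proof (rule image_subsetI)
    fix i assume "i \<in> {i\<in>{..<S}. rotate i v = w}"
    then have "rotate (i + c) w = w" using c by (metis (mono_tags, lifting) mem_Collect_eq rotate_rotate)
    then have "rotate ((i + c) mod S) w = w" using len by (metis rotate_conv_mod)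
    then show "(i + c) mod S \<in> {j\<in>{..<S}. rotate j w = w}" using assms by simp
  qed
  moreover have "inj_on (\<lambda>i. (i + c) mod S) {i\<in>{..<S}. rotate i v = w}"
  proof (rule inj_onI)
    fix x y assume "x \<in> {i\<in>{..<S}. rotate i v = w}" "y \<in> {i\<in>{..<S}. rotate i v = w}" "(x + c) mod S = (y + c) mod S"
    moreover from this(3) have "x mod S = y mod S" by (metis cong_add_rcancel_nat cong_def)
    ultimately show "x = y" by simp
  qed
  ultimately show ?thesis by (intro card_inj_on_le[of "\<lambda>i. (i + c) mod S"]) auto
qed

text \<open>Burnside's argument. Each necklace has $S$ shifts, sorted by the word they produce;
  classes of distinct necklaces are disjoint, since two necklaces in one class are each at most the
  other. Exchanging the sums counts fixed words per shift, and the shift 0 fixes all words.\<close>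

lemma num_necklaces_le:
  assumes "0 < (\<Sum>i<k. m i)"
  shows "(\<Sum>i<k. m i) * num_necklaces k m
    \<le> card (content_words k m)
      + (\<Sum>j\<in>{0<..<\<Sum>i<k. m i}. card {w \<in> content_words k m. rotate j w = w})"
proof -
  define S where "S = (\<Sum>i<k. m i)"
  define N where "N = {v \<in> content_words k m. necklace v}"
  have N: "finite N" by (simp add: N_def)
  have len: "length w = S" if "w \<in> content_words k m" for w
    using length_content_words[OF that] S_def by simp
  have cls: "rotation_class v \<subseteq> content_words k m" if "v \<in> N" for v
    using that by (auto simp: N_def rotation_class_def)
  have fin: "finite (rotation_class v)" for v by (simp add: rotation_class_eq)
  have "S = (\<Sum>w\<in>rotation_class v. card {i\<in>{..<S}. rotate i v = w})" for v
  proof -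
    have "(\<Sum>w\<in>rotation_class v. \<Sum>i\<in>{i\<in>{..<S}. rotate i v = w}. 1) = (\<Sum>i\<in>{..<S}. (1::nat))"
      using fin by (intro sum.group) (auto simp: rotation_class_def)
    then show ?thesis by simp
  qed
  then have "(\<Sum>v\<in>N. S) = (\<Sum>v\<in>N. \<Sum>w\<in>rotation_class v. card {i\<in>{..<S}. rotate i v = w})" by simp
  also have "\<dots> \<le> (\<Sum>v\<in>N. \<Sum>w\<in>rotation_class v. card {j\<in>{..<S}. rotate j w = w})"
  proof (intro sum_mono)
    fix v w assume v: "v \<in> N" and "w \<in> rotation_class v"
    then obtain i0 where "w = rotate i0 v" by (auto simp: rotation_class_def)
    then show "card {i\<in>{..<S}. rotate i v = w} \<le> card {j\<in>{..<S}. rotate j w = w}"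
      using v assms len[of v] by (intro card_rotations_to_le) (auto simp: N_def S_def)
  qed
  also have "\<dots> = (\<Sum>w\<in>(\<Union>v\<in>N. rotation_class v). card {j\<in>{..<S}. rotate j w = w})"
  proof (rule sum.UNION_disjoint[symmetric])
    show "\<forall>v\<in>N. \<forall>u\<in>N. v \<noteq> u \<longrightarrow> rotation_class v \<inter> rotation_class u = {}"
    proof (intro ballI impI, rule ccontr)
      fix v u assume vu: "v \<in> N" "u \<in> N" "v \<noteq> u" "rotation_class v \<inter> rotation_class u \<noteq> {}"
      then obtain i j where "rotate i v = rotate j u" by (auto simp: rotation_class_def)
      then have "rotation_class v = rotation_class u" by (metis rotation_class_rotate)
      moreover have "v \<in> rotation_class v" "u \<in> rotation_class u"
        by (auto simp: rotation_class_def intro: exI[of _ 0])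
      ultimately have "v \<le> u" "u \<le> v" using vu by (auto simp: N_def necklace_def)
      then show False using vu by simp
    qed
  qed (use N fin in auto)
  also have "\<dots> \<le> (\<Sum>w\<in>content_words k m. card {j\<in>{..<S}. rotate j w = w})"
    using cls by (intro sum_mono2) auto
  also have "\<dots> = (\<Sum>w\<in>content_words k m. \<Sum>j\<in>{..<S}. if rotate j w = w then 1 else 0)"
    by (simp add: sum.If_cases Int_def)
  also have "\<dots> = (\<Sum>j\<in>{..<S}. \<Sum>w\<in>content_words k m. if rotate j w = w then 1 else 0)"
    by (rule sum.swap)
  also have "\<dots> = (\<Sum>j\<in>{..<S}. card {w \<in> content_words k m. rotate j w = w})"
    by (simp add: sum.If_cases Int_def)
  also have "{..<S} = insert 0 {0<..<S}" using assms S_def by auto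
  also have "(\<Sum>j\<in>insert 0 {0<..<S}. card {w \<in> content_words k m. rotate j w = w})
      = card (content_words k m) + (\<Sum>j\<in>{0<..<S}. card {w \<in> content_words k m. rotate j w = w})"
    by simp
  finally have "card N * S \<le> card (content_words k m) + (\<Sum>j\<in>{0<..<S}. card {w \<in> content_words k m. rotate j w = w})"
    by simp
  moreover have "N = {w \<in> words k. necklace w \<and> has_content k m w}" by (auto simp: N_def content_words_def)
  ultimately show ?thesis by (simp add: num_necklaces_def S_def mult.commute)
qed

text \<open>Gather all copies of \<open>i\<close> in front; \<open>l\<close> ensures that something
  follows.\<close>

lemma exists_primitive_content_word:
  assumes i: "i < k" "0 < m i" and l: "l < k" "l \<noteq> i" "0 < m l"
  shows "\<exists>w \<in> content_words k m. primitive w"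
proof -
  obtain v where v: "v \<in> content_words k (m(i := 0))" using content_words_nonempty by blast
  then have cnt: "count_list v x = (m(i := 0)) x" if "x < k" for x
    using that by (simp add: content_words_def has_content_def)
  have "i \<notin> set v" using cnt[of i] i by (simp add: count_list_0_iff)
  moreover have "v \<noteq> []" using cnt[of l] l by auto
  ultimately have "primitive (replicate (m i) i @ v)" using i by (intro primitive_block_append)
  moreover have "count_list (replicate c y) x = (if x = y then c else 0)" for c and x y :: nat
    by (induction c) auto
  then have "replicate (m i) i @ v \<in> content_words k m"
    using v cnt i by (auto simp: content_words_def words_def has_content_def)
  ultimately show ?thesis by blast
qed

lemma card_imprimitive_content_words_less:
  assumes "i < k" "0 < m i" "l < k" "l \<noteq> i" "0 < m l"
  shows "card {w \<in> content_words k m. \<not> primitive w} < card (content_words k m)"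
  using exists_primitive_content_word[of i k m l] assms by (intro psubset_card_mono) auto

text \<open>Classification by the first letter. Symbols with \<open>m i = 0\<close> are left out
  because the truncated \<open>m i - 1\<close> would count words that arise from no
  deletion.\<close>

lemma sum_card_content_words_decrement:
  assumes "\<exists>i<k. 0 < m i"
  shows "(\<Sum>i | i < k \<and> 0 < m i. card (content_words k (m(i := m i - 1)))) = card (content_words k m)"
proof -
  let ?I = "{i. i < k \<and> 0 < m i}"
  have "content_words k m = (\<Union>i\<in>?I. Cons i ` content_words k (m(i := m i - 1)))"
  proof (intro equalityI subsetI)
    fix w assume w: "w \<in> content_words k m"
    obtain l where l: "l < k" "0 < m l" using assms by blast
    then have "count_list w l > 0" using w by (simp add: content_words_def has_content_def)
    then obtain i v where iv: "w = i # v" by (cases w) auto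
    have "i < k" using w iv by (simp add: content_words_def words_def)
    moreover have "m i = Suc (count_list v i)"
      using w iv \<open>i < k\<close> by (auto simp: content_words_def has_content_def)
    moreover have "v \<in> content_words k (m(i := m i - 1))"
      using w iv \<open>m i = _\<close> by (auto simp: content_words_def words_def has_content_def)
    ultimately show "w \<in> (\<Union>i\<in>?I. Cons i ` content_words k (m(i := m i - 1)))" using iv by auto
  next
    fix w assume "w \<in> (\<Union>i\<in>?I. Cons i ` content_words k (m(i := m i - 1)))"
    then obtain i v where "i < k" "0 < m i" "w = i # v" "v \<in> content_words k (m(i := m i - 1))" by auto
    then show "w \<in> content_words k m" by (auto simp: content_words_def words_def has_content_def)
  qed
  then have "card (content_words k m) = card (\<Union>i\<in>?I. Cons i ` content_words k (m(i := m i - 1)))" by simp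
  also have "\<dots> = (\<Sum>i\<in>?I. card (Cons i ` content_words k (m(i := m i - 1))))"
    by (rule card_UN_disjoint) auto
  finally show ?thesis by (simp add: card_image)
qed

section \<open>Separating a symbol from the rest of the word\<close>

lemma filter_content_words:
  assumes "w \<in> content_words k m"
  shows "filter (\<lambda>x. x \<noteq> s) w \<in> content_words k (m(s := 0))"
proof -
  have "count_list (filter (\<lambda>x. x \<noteq> s) w) x = (if x = s then 0 else count_list w x)" for x
    by (induction w) auto
  then show ?thesis using assms by (auto simp: content_words_def words_def has_content_def)
qed

lemma map_content_words:
  assumes "w \<in> content_words k m" "s < k"
  shows "map (\<lambda>x. x = s) w \<in> bool_words (\<Sum>i<k. m i) (m s)"
proof -
  have "count_list (map (\<lambda>x. x = s) w) True = count_list w s" by (induction w) auto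
  then show ?thesis using assms length_content_words[OF assms(1)]
    by (simp add: bool_words_def content_words_def has_content_def)
qed

text \<open>The pattern tells at each position whether to read \<open>s\<close> or the next
  remaining letter.\<close>

lemma inj_pattern_filter: "inj (\<lambda>w. (map (\<lambda>x. x = s) w, filter (\<lambda>x. x \<noteq> s) w))"
proof (rule injI)
  fix v w assume "(map (\<lambda>x. x = s) v, filter (\<lambda>x. x \<noteq> s) v) = (map (\<lambda>x. x = s) w, filter (\<lambda>x. x \<noteq> s) w)"
  then have "length v = length w" "map (\<lambda>x. x = s) v = map (\<lambda>x. x = s) w" "filter (\<lambda>x. x \<noteq> s) v = filter (\<lambda>x. x \<noteq> s) w"
    by (auto dest: map_eq_imp_length_eq)
  then show "v = w" by (induction v w rule: list_induct2) (auto split: if_splits)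
qed

lemma card_le_pattern_filter:
  assumes "\<And>w. w \<in> A \<Longrightarrow> map (\<lambda>x. x = s) w \<in> P" "\<And>w. w \<in> A \<Longrightarrow> filter (\<lambda>x. x \<noteq> s) w \<in> R"
    and "finite P" "finite R"
  shows "card A \<le> card P * card R"
proof -
  have "card A \<le> card (P \<times> R)"
    using assms by (intro card_inj_on_le[OF inj_on_subset[OF inj_pattern_filter[of s]]]) auto
  then show ?thesis by (simp add: card_cartesian_product)
qed

lemma card_imprimitive_content_words_le:
  assumes "s < k"
  shows "card {w \<in> content_words k m. \<not> primitive w}
    \<le> card {p \<in> bool_words (\<Sum>i<k. m i) (m s). \<not> primitive p}
      * card {r \<in> content_words k (m(s := 0)). \<not> primitive r}"
proof (intro card_le_pattern_filter[where s = s])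
  fix w assume w: "w \<in> {w \<in> content_words k m. \<not> primitive w}"
  then show "map (\<lambda>x. x = s) w \<in> {p \<in> bool_words (\<Sum>i<k. m i) (m s). \<not> primitive p}"
    using map_content_words[OF _ assms] imprimitive_map by blast
  show "filter (\<lambda>x. x \<noteq> s) w \<in> {r \<in> content_words k (m(s := 0)). \<not> primitive r}"
    using w filter_content_words imprimitive_filter by blast
qed auto

text \<open>The pattern is fixed by the same shift. The induced shift of the remainder depends on
  how many letters \<open>s\<close> are passed, so only its imprimitivity is recorded.\<close>

lemma card_fixed_content_words_le:
  assumes "s < k" "0 < j" "j < (\<Sum>i<k. m i)"
  shows "card {w \<in> content_words k m. rotate j w = w}
    \<le> card {p \<in> bool_words (\<Sum>i<k. m i) (m s). rotate j p = p}
      * card {r \<in> content_words k (m(s := 0)). \<not> primitive r}"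
proof (intro card_le_pattern_filter[where s = s])
  fix w assume w: "w \<in> {w \<in> content_words k m. rotate j w = w}"
  then have "\<not> primitive w" using assms length_content_words[of w k m] by (auto simp: primitive_def)
  then show "filter (\<lambda>x. x \<noteq> s) w \<in> {r \<in> content_words k (m(s := 0)). \<not> primitive r}"
    using w filter_content_words imprimitive_filter by blast
  show "map (\<lambda>x. x = s) w \<in> {p \<in> bool_words (\<Sum>i<k. m i) (m s). rotate j p = p}"
    using w map_content_words[OF _ assms(1)] by (auto simp: rotate_map)
qed auto

text \<open>For the set of all words the separation is also onto: they are the shuffles of a block
  of \<open>s\<close> with the remainders.\<close>

lemma card_content_words_filter:
  assumes "s < k"
  shows "card (content_words k m) = ((\<Sum>i<k. m i) choose m s) * card (content_words k (m(s := 0)))"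
proof -
  define R where "R = content_words k (m(s := 0))"
  define a where "a = replicate (m s) s"
  have cnt: "count_list (replicate c y) x = (if x = y then c else 0)" for c and x y :: nat
    by (induction c) auto
  have notin: "s \<notin> set r" if "r \<in> R" for r
    using that assms by (auto simp: R_def content_words_def has_content_def count_list_0_iff)
  have shuf: "filter (\<lambda>x. x \<noteq> s) w = r" "\<And>x. count_list w x = count_list a x + count_list r x" "set w = set a \<union> set r"
    if "w \<in> shuffles a r" "r \<in> R" for w r
  proof -
    have dis: "set a \<inter> set r = {}" using notin[OF that(2)] by (auto simp: a_def)
    show "set w = set a \<union> set r" by (rule set_shuffles[OF that(1)])
    show "count_list w x = count_list a x + count_list r x" for x
      using that(1) by (induction a r arbitrary: w rule: shuffles.induct) auto
    have "filter (\<lambda>x. x \<in> set r) w = r" by (rule filter_shuffles_disjoint2(1)[OF dis that(1)])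
    moreover have "filter (\<lambda>x. x \<noteq> s) w = filter (\<lambda>x. x \<in> set r) w"
      using notin[OF that(2)] \<open>set w = _\<close> by (intro filter_cong) (auto simp: a_def split: if_splits)
    ultimately show "filter (\<lambda>x. x \<noteq> s) w = r" by simp
  qed
  have eq: "content_words k m = (\<Union>r\<in>R. shuffles a r)"
  proof (intro equalityI subsetI)
    fix w assume w: "w \<in> content_words k m"
    have "filter (\<lambda>x. x = s) w = replicate (count_list w s) s" by (induction w) auto
    then have "filter (\<lambda>x. x = s) w = a" using w assms by (simp add: a_def content_words_def has_content_def)
    then have "w \<in> shuffles a (filter (\<lambda>x. x \<noteq> s) w)" using partition_in_shuffles[of w "\<lambda>x. x = s"] by simp
    then show "w \<in> (\<Union>r\<in>R. shuffles a r)" using filter_content_words[OF w] by (auto simp: R_def)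
  next
    fix w assume "w \<in> (\<Union>r\<in>R. shuffles a r)"
    then obtain r where r: "r \<in> R" "w \<in> shuffles a r" by blast
    have "set w \<subseteq> {..<k}"
      using r(1) assms unfolding shuf(3)[OF r(2,1)] by (auto simp: R_def a_def content_words_def words_def)
    moreover have "count_list w x = m x" if "x < k" for x
    proof (cases "x = s")
      case True
      then show ?thesis using shuf(2)[OF r(2,1), of s] notin[OF r(1)] by (simp add: a_def cnt)
    next
      case False
      moreover have "count_list r x = m x"
        using r(1) that False by (simp add: R_def content_words_def has_content_def)
      ultimately show ?thesis using shuf(2)[OF r(2,1), of x] by (simp add: a_def cnt)
    qed
    ultimately show "w \<in> content_words k m" by (simp add: content_words_def words_def has_content_def)
  qed
  have "card (content_words k m) = (\<Sum>r\<in>R. card (shuffles a r))"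
    unfolding eq using shuf(1) by (intro card_UN_disjoint) (auto simp: R_def)
  also have "\<dots> = (\<Sum>r\<in>R. (\<Sum>i<k. m i) choose m s)"
  proof (rule sum.cong)
    fix r assume r: "r \<in> R"
    have "m s + (\<Sum>i<k. (m(s := 0)) i) = (\<Sum>i<k. m i)"
      using assms sum.remove[of "{..<k}" s m] sum.remove[of "{..<k}" s "m(s := 0)"] by simp
    then have "length a + length r = (\<Sum>i<k. m i)"
      using length_content_words[of r k "m(s := 0)"] r by (simp add: R_def a_def)
    moreover have "set a \<inter> set r = {}" using notin[OF r] by (auto simp: a_def)
    moreover have "length a = m s" by (simp add: a_def)
    ultimately show "card (shuffles a r) = (\<Sum>i<k. m i) choose m s"
      using card_disjoint_shuffles[of a r] by simp
  qed simp
  finally show ?thesis by (simp add: R_def)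
qed

section \<open>Combining the counts, and strictness\<close>

theorem theorem1p2:
  fixes k :: nat and n :: "nat \<Rightarrow> nat"
  assumes "k \<ge> 2" and "\<And>i. i < k \<Longrightarrow> n i \<ge> 1"
  shows "num_necklaces k n \<le> (\<Sum>i<k. num_lyndon k (n(i := n i - 1)))
    \<and> (k > 2 \<longrightarrow> num_necklaces k n < (\<Sum>i<k. num_lyndon k (n(i := n i - 1))))"
proof -
  define T where "T = (\<Sum>i<k. n i)"
  define W where "W = content_words k"
  define NP where "NP m = card {w \<in> W m. \<not> primitive w}" for m
  define dec where "dec m i = m(i := m i - 1)" for m :: "nat \<Rightarrow> nat" and i
  define L where "L = (\<Sum>i<k. num_lyndon k (dec n i))"
  have pos: "0 < n i" if "i < k" for i using assms(2)[OF that] by simp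
  obtain s where s: "s < k" "\<And>i. i < k \<Longrightarrow> n s \<le> n i"
    using ex_has_least_nat[of "\<lambda>i. i < k" 0 n] assms(1) by auto
  define a where "a = n s"
  define rest where "rest = n(s := 0)"
  have a: "1 \<le> a" using pos[OF s(1)] by (simp add: a_def)
  define t where "t = (if s = 0 then 1 else 0 :: nat)"
  have t: "t < k" "t \<noteq> s" using assms(1) by (auto simp: t_def)
  have T: "2 * a \<le> T"
  proof -
    have "(\<Sum>i\<in>{s, t}. n i) \<le> T" unfolding T_def using s(1) t by (intro sum_mono2) auto
    then show ?thesis using t s(2)[OF t(1)] by (simp add: a_def)
  qed
  define Q where "Q = (\<Sum>j\<in>{0<..<T}. card {w \<in> bool_words T a. rotate j w = w})"
  define R1 where "R1 = card {w \<in> bool_words (T - 1) a. \<not> primitive w}"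
  define R2 where "R2 = card {w \<in> bool_words (T - 1) (a - 1). \<not> primitive w}"
  define P where "P = (\<Sum>i\<in>{..<k} - {s}. NP (dec rest i))"
  have bin: "(T - 1) * Q + T * R1 + T * R2 \<le> T choose a"
    unfolding Q_def R1_def R2_def by (rule bool_words_inequality[OF a T])
  have sum_dec: "(\<Sum>j<k. dec n i j) = T - 1" if "i < k" for i
    using that pos[OF that] sum.remove[of "{..<k}" i n] sum.remove[of "{..<k}" i "dec n i"]
    by (simp add: T_def dec_def)

  \<comment> \<open>Lower bound for \<open>L\<close>: delete the first letter and split the tails
    into primitive and imprimitive ones.\<close>
  have "(T - 1) * L = (\<Sum>i<k. (T - 1) * num_lyndon k (dec n i))" by (simp add: L_def sum_distrib_left)
  moreover have "card (W (dec n i)) \<le> (T - 1) * num_lyndon k (dec n i) + NP (dec n i)" if "i < k" for i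
  proof -
    have "card (W (dec n i)) = card ({w \<in> W (dec n i). primitive w} \<union> {w \<in> W (dec n i). \<not> primitive w})"
      by (intro arg_cong[of _ _ card]) auto
    also have "\<dots> \<le> card {w \<in> W (dec n i). primitive w} + NP (dec n i)"
      unfolding NP_def by (rule card_Un_le)
    finally show ?thesis using card_primitive_le[of k "dec n i"] sum_dec[OF that] by (simp add: W_def)
  qed
  then have "(\<Sum>i<k. card (W (dec n i))) \<le> (\<Sum>i<k. (T - 1) * num_lyndon k (dec n i) + NP (dec n i))"
    by (intro sum_mono) auto
  moreover have "(\<Sum>i<k. card (W (dec n i))) = card (W n)"
  proof -
    have "{i. i < k \<and> 0 < n i} = {..<k}" using pos by auto
    then show ?thesis using sum_card_content_words_decrement[of k n] pos s(1) by (auto simp: W_def dec_def)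
  qed
  ultimately have lower: "card (W n) \<le> (T - 1) * L + (\<Sum>i<k. NP (dec n i))"
    by (simp add: sum.distrib)

  have "T * num_necklaces k n \<le> card (W n) + (\<Sum>j\<in>{0<..<T}. card {w \<in> W n. rotate j w = w})"
    unfolding T_def W_def by (rule num_necklaces_le) (use a T in \<open>simp add: T_def\<close>)
  also have "(\<Sum>j\<in>{0<..<T}. card {w \<in> W n. rotate j w = w})
      \<le> (\<Sum>j\<in>{0<..<T}. card {w \<in> bool_words T a. rotate j w = w} * NP rest)"
    unfolding NP_def rest_def W_def a_def T_def using s(1)
    by (intro sum_mono card_fixed_content_words_le) auto
  also have "\<dots> = Q * NP rest" by (simp add: Q_def sum_distrib_right)
  finally have upper: "T * num_necklaces k n \<le> card (W n) + Q * NP rest" by simp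

  \<comment> \<open>Deleting \<open>s\<close> removes a mark and keeps the remainder
    \<open>rest\<close>; deleting another symbol keeps all \<open>a\<close> marks and shortens the
    remainder.\<close>
  have "(\<Sum>i<k. NP (dec n i)) = NP (dec n s) + (\<Sum>i\<in>{..<k} - {s}. NP (dec n i))"
    using s(1) by (intro sum.remove) auto
  moreover have "NP (dec n s) \<le> R2 * NP rest"
    using card_imprimitive_content_words_le[OF s(1), of "dec n s"] sum_dec[OF s(1)]
    by (simp add: NP_def R2_def W_def rest_def a_def dec_def)
  moreover have "(\<Sum>i\<in>{..<k} - {s}. NP (dec n i)) \<le> (\<Sum>i\<in>{..<k} - {s}. R1 * NP (dec rest i))"
  proof (rule sum_mono)
    fix i assume i: "i \<in> {..<k} - {s}"
    then have "(dec n i)(s := 0) = dec rest i" "dec n i s = a" by (auto simp: dec_def rest_def a_def fun_upd_twist)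
    then show "NP (dec n i) \<le> R1 * NP (dec rest i)"
      using card_imprimitive_content_words_le[OF s(1), of "dec n i"] sum_dec[of i] i
      by (simp add: NP_def R1_def W_def)
  qed
  moreover have "\<dots> = R1 * P" by (simp add: P_def sum_distrib_left)
  ultimately have imprim: "(\<Sum>i<k. NP (dec n i)) \<le> R2 * NP rest + R1 * P" by simp

  define M where "M = card (W rest)"
  have M: "card (W n) = (T choose a) * M"
    unfolding W_def M_def rest_def T_def a_def by (rule card_content_words_filter[OF s(1)])
  have "W rest \<noteq> {}" using content_words_nonempty by (auto simp: W_def)
  then have "0 < M" by (simp add: M_def W_def card_gt_0_iff)
  have "0 < T choose a" using T by simp
  have NP_le: "NP m \<le> card (W m)" for m unfolding NP_def W_def by (intro card_mono) auto
  have M_sum: "(\<Sum>i\<in>{..<k} - {s}. card (W (dec rest i))) = M"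
  proof -
    have "{i. i < k \<and> 0 < rest i} = {..<k} - {s}" using pos by (auto simp: rest_def)
    moreover have "\<exists>i<k. 0 < rest i" using pos t by (auto simp: rest_def)
    ultimately show ?thesis using sum_card_content_words_decrement[of k rest] by (simp add: W_def dec_def M_def)
  qed
  have "P \<le> M" unfolding P_def M_sum[symmetric] using NP_le by (intro sum_mono)
  have "NP rest \<le> M" unfolding M_def by (rule NP_le)
  \<comment> \<open>The total error. Replacing \<open>NP rest\<close> and \<open>P\<close> by their
    upper bound \<open>M\<close> gives at most \<open>M\<close> times the left side of
    \<open>bin\<close>, hence at most \<open>card (W n)\<close>.\<close>
  define B where "B = (T - 1) * (Q * NP rest) + T * (R2 * NP rest + R1 * P)"
  have B_eq: "B = ((T - 1) * Q + T * R2) * NP rest + T * R1 * P"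
    by (simp only: B_def distrib_left distrib_right ac_simps)
  have "((T - 1) * Q + T * R2) * M + T * R1 * M = ((T - 1) * Q + T * R1 + T * R2) * M"
    by (simp only: distrib_left distrib_right ac_simps)
  also have "\<dots> \<le> (T choose a) * M" using bin by (rule mult_le_mono1)
  finally have B_upper: "((T - 1) * Q + T * R2) * M + T * R1 * M \<le> card (W n)" by (simp only: M)
  have B_le: "B \<le> card (W n)"
    using B_upper mult_le_mono2[OF \<open>NP rest \<le> M\<close>, of "(T - 1) * Q + T * R2"] mult_le_mono2[OF \<open>P \<le> M\<close>, of "T * R1"]
    unfolding B_eq by linarith
  have B_less: "B < card (W n)" if k: "2 < k"
  proof -
    obtain u where u: "u < k" "u \<noteq> s" "u \<noteq> t"
    proof -
      have "card ({..<k} - {s, t}) \<noteq> 0" using k s(1) t by (simp add: card_Diff_subset)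
      then have "{..<k} - {s, t} \<noteq> {}" by auto
      then show ?thesis using that by blast
    qed
    have rest_less: "NP rest < M" unfolding NP_def M_def W_def
      using t u pos by (intro card_imprimitive_content_words_less[of t _ _ u]) (auto simp: rest_def)
    have P_less: "P < M" if "R1 \<noteq> 0"
    proof -
      have "a \<noteq> 1"
      proof
        assume "a = 1"
        then have "{q. prime q \<and> q dvd a \<and> q dvd T - 1} = {}" by (auto simp: prime_gt_1_nat)
        then have "R1 = 0" using card_imprimitive_bool_words_le[of "T - 1" a] T a
          unfolding R1_def by (simp only: sum.empty) simp
        then show False using that by simp
      qed
      then have "2 \<le> n t" using s(2)[OF t(1)] a by (simp add: a_def)
      then have "NP (dec rest t) < card (W (dec rest t))" unfolding NP_def W_def
        using t u pos by (intro card_imprimitive_content_words_less[of t _ _ u]) (auto simp: rest_def dec_def)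
      then show ?thesis unfolding P_def M_sum[symmetric] using t NP_le by (intro sum_strict_mono_ex1) auto
    qed
    show ?thesis
    \<comment> \<open>A strict bound on \<open>NP rest\<close> or \<open>P\<close> helps only where
      its coefficient is nonzero; if both coefficients vanish, so does \<open>B\<close>.\<close>
    proof (cases "(T - 1) * Q + T * R2 = 0 \<and> T * R1 = 0")
      case True
      then have "B = 0" unfolding B_eq by (simp only: mult_0)
      moreover have "0 < card (W n)" unfolding M using \<open>0 < M\<close> \<open>0 < T choose a\<close> by (rule mult_pos_pos[rotated])
      ultimately show ?thesis by simp
    next
      case False
      have "((T - 1) * Q + T * R2) * NP rest + T * R1 * P < ((T - 1) * Q + T * R2) * M + T * R1 * M"
      proof (cases "T * R1 = 0")
        case True
        then have "0 < (T - 1) * Q + T * R2" using False by auto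
        then show ?thesis using True rest_less by (simp only: mult_less_mono2) simp
      next
        case R1: False
        then have "T * R1 * P < T * R1 * M" using P_less by (intro mult_less_mono2) auto
        then show ?thesis using mult_le_mono2[OF \<open>NP rest \<le> M\<close>] by (intro add_le_less_mono)
      qed
      then show ?thesis unfolding B_eq using B_upper by linarith
    qed
  qed
  \<comment> \<open>The upper bound is scaled by $T - 1$ and the lower bound by $T$. The copies of
    \<open>card (W n)\<close> then cancel except for one, which has to absorb
    \<open>B\<close>.\<close>
  have "(T - 1) * (T * num_necklaces k n) \<le> (T - 1) * (card (W n) + Q * NP rest)"
    using upper by (rule mult_le_mono2)
  moreover have "T * card (W n) \<le> T * ((T - 1) * L + (R2 * NP rest + R1 * P))"
    using lower imprim by (intro mult_le_mono2) linarith
  moreover have "T * card (W n) = (T - 1) * card (W n) + card (W n)"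
    using T a by (cases T) auto
  ultimately have main: "(T - 1) * T * num_necklaces k n + card (W n) \<le> (T - 1) * T * L + B"
    unfolding B_def by (simp add: distrib_left mult.assoc mult.left_commute[of T])
  have "0 < (T - 1) * T" using T a by simp
  have "(T - 1) * T * num_necklaces k n \<le> (T - 1) * T * L" using main B_le by linarith
  then have "num_necklaces k n \<le> L" using \<open>0 < (T - 1) * T\<close> by (simp only: mult_le_cancel1)
  moreover have "num_necklaces k n < L" if "2 < k"
  proof -
    have "(T - 1) * T * num_necklaces k n < (T - 1) * T * L" using main B_less[OF that] by linarith
    then show ?thesis by (simp only: mult_less_cancel1)
  qed
  ultimately show ?thesis unfolding L_def dec_def by blast
qed

end
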